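(* Let $F(x)=\mathbb{E}_\xi[f(x;\xi)]$ on $\mathbb{R}^n$ be bounded below, $(L_0,L_1)$-smooth, with unbiased and $(G_0,G_1)$-variance-bounded stochastic gradients. Run the trust region method described in the context with symmetric matrices $B_t$ such that $\|B_t\|\le\beta$ for all $t$, for some constant $\beta\geq 0$. Let $$0<\epsilon\leq \min\left\{\frac{4L_0G_0+16\beta G_0}{L_1G_0+2L_0G_1+8\beta G_1},\ \frac{4L_0+16\beta}{L_1}\right\},$$ $\Delta_t=\Delta=(4L_0+16\beta)^{-1}\epsilon$ for all $t$, $|\mathcal S_1| = 64G_0^2\epsilon^{-2}$, and $T = 32\Delta_F (L_0+4\beta)\epsilon^{-2}$. Then $$\mathbb{E}\|\nabla F(x_{\bar t})\| \leq \epsilon,$$ where $\bar t$ is sampled uniformly at random from $\{0,1,\ldots,T-1\}$ (independently of everything else). Moreover, the total number $T\,|\mathcal S_1|$ of stochastic gradient samples used is $\mathcal O\left(\Delta_F (L_0+\beta) G_0^2\,\epsilon^{-4}\right)$ (as $\epsilon\to0^+$, with an absolute constant).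
   Context: Norms are Euclidean for vectors and spectral for matrices. $F^*:=\inf_x F(x)>-\infty$ and $\Delta_F:=F(x_0)-F^*$, assumed positive, where $x_0$ is the deterministic starting point. Fractions with zero denominator are read as $+\infty$; $|\mathcal S_1|$ and $T$ are rounded up to integers. $(L_0,L_1)$-smoothness: $F$ is differentiable and there are constants $L_0>0$, $L_1\ge 0$ such that $\|x-x'\|\le 1/L_1$ implies $\|\nabla F(x)-\nabla F(x')\|\le (L_0+L_1\|\nabla F(x)\|)\|x-x'\|$. Unbiased and $(G_0,G_1)$-variance-bounded gradients ($G_0>0$, $G_1\ge0$): $\mathbb{E}_\xi[\nabla f(x;\xi)]=\nabla F(x)$ and $\mathbb{E}_\xi\|\nabla f(x;\xi)-\nabla F(x)\|^2\le G_0^2+G_1^2\|\nabla F(x)\|^2$ for all $x$. Trust region method: for $t=0,1,\dots,T-1$, draw a fresh batch $\mathcal S_1$ of i.i.d. samples of $\xi$ (independent of the past), set $g_t=\frac1{|\mathcal S_1|}\sum_{\xi\in\mathcal S_1}\nabla f(x_t;\xi)$, let $d_{t+1}$ be a global solution of the subproblem $$\min_{d\in\mathbb{R}^n}\ m_t(d):=F(x_t)+g_t^Td+\tfrac12 d^TB_td\quad\text{s.t. } \|d\|\le\Delta_t,$$ and set $x_{t+1}=x_t+d_{t+1}$. *)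

theory Defs
  imports "HOL-Probability.Probability"
begin

(* Uniquely determined at every point where f is differentiable. *)
definition gradient :: "('a::euclidean_space \<Rightarrow> real) \<Rightarrow> 'a \<Rightarrow> 'a" where
  "gradient f x = (THE D. GDERIV f x :> D)"

lemma gradient_eqI:
  assumes "GDERIV f x :> D"
  shows "gradient f x = D"
  unfolding gradient_def
proof (rule the_equality)
  fix D' assume "GDERIV f x :> D'"
  with assms have "(\<lambda>h. inner h D') = (\<lambda>h. inner h D)"
    unfolding gderiv_def by (rule has_derivative_unique[rotated])
  then show "D' = D"
    by (metis inner_commute vector_eq_rdot)
qed (fact assms)

lemma GDERIV_gradient:
  assumes "f differentiable (at x)"
  shows "GDERIV f x :> gradient f x"
proof -
  from assms obtain f' where f': "(f has_derivative f') (at x)"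
    by (auto simp: differentiable_def)
  then have "linear f'"
    by (rule has_derivative_linear)
  then have "f' = (\<lambda>h. inner h (adjoint f' 1))"
    by (simp add: adjoint_works fun_eq_iff)
  with f' have "GDERIV f x :> adjoint f' 1"
    by (simp add: gderiv_def)
  with gradient_eqI show ?thesis
    by metis
qed

(* The radius 1 / L1 is taken in the extended reals, where it is infinite for L1 = 0. *)
definition L0L1_smooth :: "real \<Rightarrow> real \<Rightarrow> ('a::euclidean_space \<Rightarrow> real) \<Rightarrow> bool" where
  "L0L1_smooth L0 L1 F \<longleftrightarrow>
     (\<forall>x. F differentiable (at x)) \<and>
     (\<forall>x x'. ereal (norm (x - x')) \<le> 1 / ereal L1 \<longrightarrow>
        norm (gradient F x - gradient F x') \<le> (L0 + L1 * norm (gradient F x)) * norm (x - x'))"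

locale stochastic_objective = prob_space D
  for D :: "'s measure" +
  fixes f :: "'a::euclidean_space \<Rightarrow> 's \<Rightarrow> real"
    and F :: "'a \<Rightarrow> real"
  assumes integrable_f: "\<And>x. integrable D (f x)"
    and F_eq: "\<And>x. F x = expectation (f x)"
    and differentiable_f: "\<And>x s. s \<in> space D \<Longrightarrow> (\<lambda>y. f y s) differentiable (at x)"

definition stoch_grad :: "('a::euclidean_space \<Rightarrow> 's \<Rightarrow> real) \<Rightarrow> 'a \<Rightarrow> 's \<Rightarrow> 'a" where
  "stoch_grad f x s = gradient (\<lambda>y. f y s) x"

definition unbiased_gradients ::
  "'s measure \<Rightarrow> ('a::euclidean_space \<Rightarrow> 's \<Rightarrow> real) \<Rightarrow> ('a \<Rightarrow> real) \<Rightarrow> bool" where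
  "unbiased_gradients D f F \<longleftrightarrow>
     (\<forall>x. integrable D (stoch_grad f x) \<and> (\<integral>s. stoch_grad f x s \<partial>D) = gradient F x)"

definition variance_bounded_gradients ::
  "real \<Rightarrow> real \<Rightarrow> 's measure \<Rightarrow> ('a::euclidean_space \<Rightarrow> 's \<Rightarrow> real) \<Rightarrow> ('a \<Rightarrow> real) \<Rightarrow> bool" where
  "variance_bounded_gradients G0 G1 D f F \<longleftrightarrow>
     (\<forall>x. integrable D (\<lambda>s. (norm (stoch_grad f x s - gradient F x))\<^sup>2) \<and>
          (\<integral>s. (norm (stoch_grad f x s - gradient F x))\<^sup>2 \<partial>D)
            \<le> G0\<^sup>2 + G1\<^sup>2 * (norm (gradient F x))\<^sup>2)"

definition minibatch_grad ::
  "('a::euclidean_space \<Rightarrow> 's \<Rightarrow> real) \<Rightarrow> nat \<Rightarrow> 'a \<Rightarrow> (nat \<Rightarrow> 's) \<Rightarrow> 'a" where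
  "minibatch_grad f S x \<zeta> = (\<Sum>i<S. stoch_grad f x (\<zeta> i)) /\<^sub>R real S"

definition tr_model :: "real \<Rightarrow> real^'n \<Rightarrow> real^'n^'n \<Rightarrow> real^'n \<Rightarrow> real" where
  "tr_model c g B d = c + g \<bullet> d + (d \<bullet> (B *v d)) / 2"

(* A run of T steps with batches of size S.  \<xi> t i is the i-th sample of the batch drawn at
   step t.  The filtration \<F> carries the past: \<F> t contains everything generated before that
   batch is drawn, possibly including extra randomness, such as the one used to choose among
   several solutions of a subproblem or to choose the matrices B t. *)
locale trust_region_method = prob_space M + filtration "space M" \<F>
  for M :: "'w measure" and \<F> :: "nat \<Rightarrow> 'w measure" +
  fixes D :: "'s measure"
    and f :: "real^'n \<Rightarrow> 's \<Rightarrow> real"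
    and F :: "real^'n \<Rightarrow> real"
    and x0 :: "real^'n"
    and S T :: nat
    and \<Delta> :: "nat \<Rightarrow> real"
    and B :: "nat \<Rightarrow> 'w \<Rightarrow> real^'n^'n"
    and \<xi> :: "nat \<Rightarrow> nat \<Rightarrow> 'w \<Rightarrow> 's"
    and x d :: "nat \<Rightarrow> 'w \<Rightarrow> real^'n"
  assumes subalgebra: "\<And>t. subalgebra M (\<F> t)"
    and x_adapted: "\<And>t. t \<le> T \<Longrightarrow> x t \<in> borel_measurable (\<F> t)"
    and \<xi>_adapted: "\<And>t i. t < T \<Longrightarrow> i < S \<Longrightarrow> \<xi> t i \<in> measurable (\<F> (Suc t)) D"
    and batch_distr: "\<And>t i. t < T \<Longrightarrow> i < S \<Longrightarrow> distr M D (\<xi> t i) = D"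
    and batch_indep: "\<And>t. t < T \<Longrightarrow> indep_vars (\<lambda>_. D) (\<xi> t) {..<S}"
    and batch_fresh: "\<And>t. t < T \<Longrightarrow>
          indep_set
            (sets (vimage_algebra (space M) (\<lambda>\<omega>. \<lambda>i\<in>{..<S}. \<xi> t i \<omega>) (PiM {..<S} (\<lambda>_. D))))
            (sets (\<F> t))"
    and x_init: "\<And>\<omega>. \<omega> \<in> space M \<Longrightarrow> x 0 \<omega> = x0"
    and d_solves: "\<And>t \<omega>. t < T \<Longrightarrow> \<omega> \<in> space M \<Longrightarrow>
          is_arg_min
            (tr_model (F (x t \<omega>)) (minibatch_grad f S (x t \<omega>) (\<lambda>i. \<xi> t i \<omega>)) (B t \<omega>))
            (\<lambda>v. norm v \<le> \<Delta> t) (d (Suc t) \<omega>)"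
    and x_step: "\<And>t \<omega>. t < T \<Longrightarrow> \<omega> \<in> space M \<Longrightarrow> x (Suc t) \<omega> = x t \<omega> + d (Suc t) \<omega>"

definition tr_batch_size :: "real \<Rightarrow> real \<Rightarrow> nat" where
  "tr_batch_size G0 \<epsilon> = nat \<lceil>64 * G0\<^sup>2 / \<epsilon>\<^sup>2\<rceil>"

definition tr_horizon :: "real \<Rightarrow> real \<Rightarrow> real \<Rightarrow> real \<Rightarrow> nat" where
  "tr_horizon gap L0 \<beta> \<epsilon> = nat \<lceil>32 * gap * (L0 + 4 * \<beta>) / \<epsilon>\<^sup>2\<rceil>"

end

theory Submission
  imports Defs
begin

text \<open>
  Writing \<open>e\<close> for the error of the minibatch gradient and \<open>r\<close> for the radius, optimality of the
  trust region step against the step \<open>- r g / \<bar>g\<bar>\<close> gives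
  \<open>F (x + d) \<le> F x - r \<bar>\<nabla>F x\<bar> + 2 r \<bar>e\<bar> + \<beta> r\<^sup>2 + (L0 + L1 \<bar>\<nabla>F x\<bar>) r\<^sup>2 / 2\<close>.
  The batch being independent of the past, the expectation of \<open>\<bar>e\<bar>\<close> given the past is at most
  \<open>(G0 + G1 \<bar>\<nabla>F x\<bar>) / sqrt S\<close>. The bound on \<open>\<epsilon>\<close> says exactly that the terms proportional to
  \<open>\<bar>\<nabla>F x\<bar>\<close> coming from \<open>L1\<close> and \<open>G1\<close> consume at most half of the decrease \<open>r \<bar>\<nabla>F x\<bar>\<close>;
  the remaining inequality telescopes.
\<close>

section \<open>Extended-real constraints and analysis of (L0,L1)-smooth functions\<close>

lemma ereal_le_divide_imp_mult_le:
  assumes "ereal e \<le> ereal a / ereal b" "0 \<le> a" "0 \<le> b"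
  shows "e * b \<le> a"
proof (cases "b = 0")
  case False
  with assms show ?thesis
    by (simp add: pos_le_divide_eq)
qed (use assms in simp)

text \<open>Turns the radius condition into a product. For \<open>b = 0\<close> the right-hand side
  is infinite, so smoothness with \<open>L1 = 0\<close> is a global Lipschitz condition.\<close>

lemma ereal_le_inverse_if_mult_le:
  assumes "b * r \<le> 1" "0 \<le> b"
  shows "ereal r \<le> 1 / ereal b"
proof (cases "b = 0")
  case True
  then show ?thesis
    by (simp add: one_ereal_def)
next
  case False
  with assms show ?thesis
    by (simp add: one_ereal_def pos_le_divide_eq mult.commute)
qed

lemma L0L1_smoothD:
  assumes "L0L1_smooth L0 L1 F" "0 \<le> L1" "L1 * norm (x - y) \<le> 1"
  shows "norm (gradient F x - gradient F y) \<le> (L0 + L1 * norm (gradient F x)) * norm (x - y)"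
  using assms ereal_le_inverse_if_mult_le[of L1 "norm (x - y)"] by (simp add: L0L1_smooth_def)

lemma L0L1_smooth_continuous: "L0L1_smooth L0 L1 F \<Longrightarrow> continuous_on UNIV F"
  using differentiable_imp_continuous_within
  by (auto simp: L0L1_smooth_def intro!: continuous_at_imp_continuous_on)

text \<open>Near \<open>x\<close> the gradient differs from \<open>gradient F x\<close> by at most a
  constant, fixed by \<open>x\<close>, times the distance. Continuity is what later makes gradient
  norms along the run measurable, and bounded on balls.\<close>

lemma L0L1_smooth_continuous_gradient:
  assumes "L0L1_smooth L0 L1 F" "0 \<le> L1"
  shows "continuous_on UNIV (gradient F)"
proof (rule continuous_at_imp_continuous_on, rule ballI)
  fix x
  define K where "K = L0 + L1 * norm (gradient F x)"
  \<comment> \<open>Adding 1 keeps the radius positive and finite for \<open>L1 = 0\<close> while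
    still giving \<open>L1 * r \<le> 1\<close>.\<close>
  define r where "r = 1 / (L1 + 1)"
  have r: "r > 0" "L1 * r \<le> 1"
    using assms(2) by (auto simp: r_def divide_simps)
  have upper: "\<forall>\<^sub>F y in at x. dist (gradient F y) (gradient F x) \<le> K * dist y x"
    unfolding eventually_at
  proof (intro exI[of _ r] conjI ballI impI)
    fix y assume "y \<noteq> x \<and> dist y x < r"
    then have "L1 * norm (x - y) \<le> L1 * r"
      using assms(2) by (intro mult_left_mono) (auto simp: dist_norm norm_minus_commute)
    with r have "L1 * norm (x - y) \<le> 1"
      by simp
    from L0L1_smoothD[OF assms this]
    show "dist (gradient F y) (gradient F x) \<le> K * dist y x"
      by (simp add: K_def dist_norm norm_minus_commute)
  qed (use r in auto)
  have "((\<lambda>y. K * dist y x) \<longlongrightarrow> K * dist x x) (at x)"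
    by (intro tendsto_intros)
  then have "((\<lambda>y. K * dist y x) \<longlongrightarrow> 0) (at x)"
    by simp
  then have "((\<lambda>y. dist (gradient F y) (gradient F x)) \<longlongrightarrow> 0) (at x)"
    by (rule tendsto_sandwich[OF _ upper tendsto_const, rotated]) simp
  then show "isCont (gradient F) x"
    unfolding isCont_def by (rule tendsto_dist_iff[THEN iffD2])
qed

text \<open>Smoothness is always applied with \<open>x\<close> as base point, so the constant
  \<open>L0 + L1 * norm (gradient F x)\<close> does not vary along the segment from \<open>x\<close>
  to \<open>x + v\<close>.\<close>

lemma L0L1_smooth_descent:
  assumes "L0L1_smooth L0 L1 F" "0 \<le> L1" "L1 * norm v \<le> 1"
  shows "F (x + v) \<le> F x + gradient F x \<bullet> v + (L0 + L1 * norm (gradient F x)) / 2 * (norm v)\<^sup>2"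
proof -
  define K where "K = L0 + L1 * norm (gradient F x)"
  \<comment> \<open>\<open>F\<close> along the segment minus the non-constant terms of the claimed
    quadratic bound. The claim is \<open>\<phi> 1 \<le> \<phi> 0\<close>, so a nonpositive
    derivative on the unit interval suffices.\<close>
  define \<phi> where "\<phi> s = F (x + s *\<^sub>R v) - s * (gradient F x \<bullet> v) - K / 2 * (norm v)\<^sup>2 * s\<^sup>2" for s
  have "\<phi> 0 \<ge> \<phi> 1"
  proof (rule DERIV_nonpos_imp_nonincreasing[where f = \<phi>])
    fix s :: real assume s: "0 \<le> s" "s \<le> 1"
    define D where "D = v \<bullet> gradient F (x + s *\<^sub>R v) - v \<bullet> gradient F x - K * (norm v)\<^sup>2 * s"
    have "(F has_derivative (\<lambda>h. h \<bullet> gradient F (x + s *\<^sub>R v))) (at (x + s *\<^sub>R v))"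
      using assms(1) GDERIV_gradient[of F "x + s *\<^sub>R v"] by (simp add: L0L1_smooth_def gderiv_def)
    then have "((\<lambda>s. F (x + s *\<^sub>R v)) has_derivative
        (\<lambda>h. (h *\<^sub>R v) \<bullet> gradient F (x + s *\<^sub>R v))) (at s)"
      by (rule has_derivative_compose[rotated, where g = F]) (auto intro!: derivative_eq_intros)
    then have "((\<lambda>s. F (x + s *\<^sub>R v)) has_field_derivative v \<bullet> gradient F (x + s *\<^sub>R v)) (at s)"
      by (simp add: has_field_derivative_def mult.commute[of _ "v \<bullet> _"])
    then have "(\<phi> has_field_derivative D) (at s)"
      unfolding \<phi>_def D_def by (auto intro!: derivative_eq_intros simp: inner_commute)
    moreover have "D \<le> 0"
    proof -
      have "L1 * norm (x - (x + s *\<^sub>R v)) \<le> 1 * (L1 * norm v)"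
        using mult_right_mono[OF s(2), of "L1 * norm v"] s(1) assms(2) by (simp add: mult_ac)
      with assms(3) have "L1 * norm (x - (x + s *\<^sub>R v)) \<le> 1"
        by linarith
      from L0L1_smoothD[OF assms(1,2) this]
      have *: "norm (gradient F (x + s *\<^sub>R v) - gradient F x) \<le> K * (s * norm v)"
        using s by (simp add: K_def norm_minus_commute)
      have "v \<bullet> gradient F (x + s *\<^sub>R v) - v \<bullet> gradient F x
          \<le> norm v * norm (gradient F (x + s *\<^sub>R v) - gradient F x)"
        unfolding inner_diff_right[symmetric] by (rule norm_cauchy_schwarz)
      also have "\<dots> \<le> norm v * (K * (s * norm v))"
        by (intro mult_left_mono * norm_ge_zero)
      finally show ?thesis
        by (simp add: D_def power2_eq_square mult_ac)
    qed
    ultimately show "\<exists>y. (\<phi> has_field_derivative y) (at s) \<and> y \<le> 0"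
      by blast
  qed simp
  then show ?thesis
    by (simp add: \<phi>_def K_def)
qed

section \<open>Deterministic decrease achieved by one trust region step\<close>

lemma abs_quadratic_form_le:
  fixes B :: "real^'n^'n"
  assumes "onorm ((*v) B) \<le> \<beta>"
  shows "\<bar>v \<bullet> (B *v v)\<bar> \<le> \<beta> * (norm v)\<^sup>2"
proof -
  have "norm (B *v v) \<le> onorm ((*v) B) * norm v"
    by (rule onorm[OF matrix_vector_mul_bounded_linear])
  also have "\<dots> \<le> \<beta> * norm v"
    using assms by (intro mult_right_mono) auto
  finally have "norm v * norm (B *v v) \<le> norm v * (\<beta> * norm v)"
    by (intro mult_left_mono) auto
  with Cauchy_Schwarz_ineq2[of v "B *v v"] show ?thesis
    by (simp add: power2_eq_square mult_ac)
qed

lemma tr_model_arg_min_decrease: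
  fixes B :: "real^'n^'n"
  assumes "is_arg_min (tr_model c g B) (\<lambda>v. norm v \<le> r) d" "onorm ((*v) B) \<le> \<beta>" "0 \<le> r"
  shows "g \<bullet> d \<le> - r * norm g + \<beta> * r\<^sup>2"
proof -
  \<comment> \<open>The steepest descent step to the boundary. For \<open>g = 0\<close> division by
    zero gives \<open>v = 0\<close>, and both facts below remain true.\<close>
  define v where "v = (- r / norm g) *\<^sub>R g"
  have v: "norm v \<le> r" "g \<bullet> v = - r * norm g"
    using assms(3) by (auto simp: v_def dot_square_norm power2_eq_square)
  have d: "norm d \<le> r" and le: "tr_model c g B d \<le> tr_model c g B v"
    using assms(1) v by (auto simp: is_arg_min_def not_less)
  \<comment> \<open>The sign of \<open>\<beta>\<close> comes from the operator norm it dominates; it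
    makes the bound on the quadratic form monotone in the length of the vector. The forms at
    \<open>d\<close> and at \<open>v\<close> each cost half of
    \<open>\<beta> * r\<^sup>2\<close>.\<close>
  have "0 \<le> \<beta>"
    using onorm_pos_le[OF matrix_vector_mul_bounded_linear, of B] assms(2) by linarith
  then have bound: "\<bar>u \<bullet> (B *v u)\<bar> \<le> \<beta> * r\<^sup>2" if "norm u \<le> r" for u
    using abs_quadratic_form_le[OF assms(2), of u] that
      mult_left_mono[OF power_mono[OF that norm_ge_zero, of 2], of \<beta>] by linarith
  show ?thesis
    using le bound[OF d] bound[OF v(1)] v(2) by (simp add: tr_model_def field_simps)
qed

text \<open>The gradient error enters twice, whence the factor 2: once when the true gradient is
  replaced by \<open>g\<close> in the linear term of the descent inequality, and once when
  \<open>norm g\<close> is replaced by the true gradient norm in the model decrease.\<close>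

lemma trust_region_step_decrease:
  fixes B :: "real^'n^'n"
  assumes smooth: "L0L1_smooth L0 L1 F" "0 \<le> L0" "0 \<le> L1" "L1 * r \<le> 1"
    and d: "is_arg_min (tr_model c g B) (\<lambda>v. norm v \<le> r) d"
    and B: "onorm ((*v) B) \<le> \<beta>" and r: "0 \<le> r"
  shows "F (x + d) \<le> F x - r * norm (gradient F x) + 2 * r * norm (g - gradient F x)
    + \<beta> * r\<^sup>2 + (L0 + L1 * norm (gradient F x)) / 2 * r\<^sup>2"
proof -
  have nd: "norm d \<le> r"
    using d by (simp add: is_arg_min_def)
  then have "L1 * norm d \<le> 1"
    using mult_left_mono[OF nd \<open>0 \<le> L1\<close>] smooth(4) by linarith
  note L0L1_smooth_descent[OF smooth(1,3) this, of x]
  moreover have "(L0 + L1 * norm (gradient F x)) / 2 * (norm d)\<^sup>2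
      \<le> (L0 + L1 * norm (gradient F x)) / 2 * r\<^sup>2"
    using nd smooth by (intro mult_left_mono power_mono) auto
  moreover have "gradient F x \<bullet> d \<le> g \<bullet> d + r * norm (g - gradient F x)"
  proof -
    have "gradient F x \<bullet> d - g \<bullet> d \<le> norm (gradient F x - g) * norm d"
      unfolding inner_diff_left[symmetric] by (rule norm_cauchy_schwarz)
    also have "\<dots> \<le> norm (g - gradient F x) * r"
      by (metis mult_left_mono nd norm_ge_zero norm_minus_commute)
    finally show ?thesis
      by (simp add: mult.commute)
  qed
  moreover have "- r * norm g \<le> - r * norm (gradient F x) + r * norm (g - gradient F x)"
  proof -
    have "norm (gradient F x) \<le> norm g + norm (g - gradient F x)"
      by (metis add.commute norm_minus_commute norm_triangle_sub)
    from mult_left_mono[OF this r] show ?thesis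
      by (simp add: algebra_simps)
  qed
  ultimately show ?thesis
    using tr_model_arg_min_decrease[OF d B r] by linarith
qed

section \<open>Joint measurability of the stochastic gradient in point and sample\<close>

lemma borel_measurable_caratheodory:
  fixes f :: "'a::{metric_space, second_countable_topology} \<Rightarrow> 's \<Rightarrow> real"
  assumes [measurable]: "\<And>x. f x \<in> borel_measurable D"
    and cont: "\<And>x s. s \<in> space D \<Longrightarrow> isCont (\<lambda>y. f y s) x"
  shows "(\<lambda>p. f (fst p) (snd p)) \<in> borel_measurable (borel \<Otimes>\<^sub>M D)"
proof -
  \<comment> \<open>Simple functions converging pointwise to the identity. With \<open>q n\<close>
    in the first argument only finitely many sections of \<open>f\<close> occur, so the composite is
    jointly measurable; continuity of \<open>f\<close> in the point passes this to the
    limit.\<close>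
  obtain q :: "nat \<Rightarrow> 'a \<Rightarrow> 'a"
    where q: "\<And>n. simple_function borel (q n)" "\<And>x. (\<lambda>n. q n x) \<longlonglongrightarrow> x"
    using borel_measurable_implies_sequence_metric[of "\<lambda>x::'a. x" borel undefined]
    by (metis UNIV_I measurable_ident_sets space_borel)
  show ?thesis
  proof (rule borel_measurable_LIMSEQ_metric)
    fix n
    have "q n \<in> measurable borel (count_space (range (q n)))"
      using q(1)[of n] by (subst measurable_count_space_eq2) (auto simp: simple_function_def)
    then have q': "(\<lambda>p. q n (fst p)) \<in> measurable (borel \<Otimes>\<^sub>M D) (count_space (range (q n)))"
      by (rule measurable_compose[OF measurable_fst])
    have "countable (range (q n))"
      using q(1)[of n] by (auto simp: simple_function_def intro: countable_finite)
    with q' show "(\<lambda>p. f (q n (fst p)) (snd p)) \<in> borel_measurable (borel \<Otimes>\<^sub>M D)"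
      by (rule measurable_compose_countable'[where f = "\<lambda>y p. f y (snd p)", rotated]) measurable
  next
    fix p assume "p \<in> space (borel \<Otimes>\<^sub>M D :: ('a \<times> 's) measure)"
    then have "isCont (\<lambda>y. f y (snd p)) (fst p)"
      by (intro cont) (auto simp: space_pair_measure)
    then show "(\<lambda>n. f (q n (fst p)) (snd p)) \<longlonglongrightarrow> f (fst p) (snd p)"
      using q(2) by (rule isCont_tendsto_compose)
  qed
qed

text \<open>Each coordinate of the gradient is a pointwise limit of difference quotients of
  \<open>f\<close> with step \<open>1 / (n + 1)\<close>, and these are jointly measurable. Joint
  measurability allows a random iterate to be substituted for the point.\<close>

lemma (in stochastic_objective) stoch_grad_measurable:
  "(\<lambda>p. stoch_grad f (fst p) (snd p)) \<in> borel_measurable (borel \<Otimes>\<^sub>M D)"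
proof (rule borel_measurable_euclidean_space[THEN iffD2], rule ballI)
  fix b :: 'a assume "b \<in> Basis"
  have joint: "(\<lambda>p. f (fst p) (snd p)) \<in> borel_measurable (borel \<Otimes>\<^sub>M D)"
    using integrable_f differentiable_f
    by (intro borel_measurable_caratheodory differentiable_imp_continuous_within) auto
  have shift: "(\<lambda>p. f (fst p + c) (snd p)) \<in> borel_measurable (borel \<Otimes>\<^sub>M D)" for c
    using measurable_compose[of "\<lambda>p. (fst p + c, snd p)" "borel \<Otimes>\<^sub>M D" "borel \<Otimes>\<^sub>M D", OF _ joint]
    by simp
  show "(\<lambda>p. stoch_grad f (fst p) (snd p) \<bullet> b) \<in> borel_measurable (borel \<Otimes>\<^sub>M D)"
  proof (rule borel_measurable_LIMSEQ_metric)
    fix n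
    show "(\<lambda>p. (f (fst p + inverse (real (Suc n)) *\<^sub>R b) (snd p) - f (fst p) (snd p))
        / inverse (real (Suc n))) \<in> borel_measurable (borel \<Otimes>\<^sub>M D)"
      by (intro borel_measurable_divide borel_measurable_diff joint shift borel_measurable_const)
  next
    fix p assume "p \<in> space (borel \<Otimes>\<^sub>M D :: ('a \<times> 's) measure)"
    then have "GDERIV (\<lambda>y. f y (snd p)) (fst p) :> stoch_grad f (fst p) (snd p)"
      unfolding stoch_grad_def
      by (intro GDERIV_gradient differentiable_f) (auto simp: space_pair_measure)
    then have "((\<lambda>y. f y (snd p)) has_derivative (\<lambda>h. h \<bullet> stoch_grad f (fst p) (snd p)))
        (at (fst p + 0 *\<^sub>R b))"
      by (simp add: gderiv_def)
    then have "((\<lambda>h. f (fst p + h *\<^sub>R b) (snd p)) has_derivative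
        (\<lambda>h. (h *\<^sub>R b) \<bullet> stoch_grad f (fst p) (snd p))) (at 0)"
      by (rule has_derivative_compose[rotated, where g = "\<lambda>y. f y (snd p)"])
        (auto intro!: derivative_eq_intros)
    then have "((\<lambda>h. f (fst p + h *\<^sub>R b) (snd p)) has_field_derivative
        stoch_grad f (fst p) (snd p) \<bullet> b) (at 0)"
      by (simp add: has_field_derivative_def inner_commute[of b] mult.commute[of _ "_ \<bullet> b"])
    then have "((\<lambda>h. (f (fst p + h *\<^sub>R b) (snd p) - f (fst p) (snd p)) / h) \<longlongrightarrow>
        stoch_grad f (fst p) (snd p) \<bullet> b) (at 0)"
      by (simp add: DERIV_def)
    then show "(\<lambda>n. (f (fst p + inverse (real (Suc n)) *\<^sub>R b) (snd p) - f (fst p) (snd p))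
        / inverse (real (Suc n))) \<longlonglongrightarrow> stoch_grad f (fst p) (snd p) \<bullet> b"
      using LIMSEQ_inverse_real_of_nat
      by (auto simp: tendsto_at_iff_sequentially o_def)
  qed
qed

section \<open>Mean error of a minibatch gradient at a fixed point\<close>

lemma (in prob_space) expectation_le_sqrt_second_moment:
  fixes X :: "'a \<Rightarrow> real"
  assumes "X \<in> borel_measurable M" "integrable M (\<lambda>\<omega>. (X \<omega>)\<^sup>2)"
  shows "expectation X \<le> sqrt (expectation (\<lambda>\<omega>. (X \<omega>)\<^sup>2))"
  using variance_eq[OF square_integrable_imp_integrable[OF assms] assms(2)] variance_positive[of X]
  by (intro real_le_rsqrt) simp

text \<open>Independent centred vectors are orthogonal in mean square, so only the diagonal of the
  expanded square survives. Inner products are split along a basis so that the product rule for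
  independent scalars applies to each coordinate.\<close>

lemma (in prob_space) second_moment_sum_indep_centered:
  fixes Z :: "'i \<Rightarrow> 'a \<Rightarrow> 'b::euclidean_space"
  assumes "finite I" and indep: "indep_vars (\<lambda>_. borel) Z I"
    and int: "\<And>i. i \<in> I \<Longrightarrow> integrable M (Z i)"
    and mean: "\<And>i. i \<in> I \<Longrightarrow> expectation (Z i) = 0"
    and square: "\<And>i. i \<in> I \<Longrightarrow> integrable M (\<lambda>\<omega>. (norm (Z i \<omega>))\<^sup>2)"
  shows "integrable M (\<lambda>\<omega>. (norm (\<Sum>i\<in>I. Z i \<omega>))\<^sup>2)"
    and "expectation (\<lambda>\<omega>. (norm (\<Sum>i\<in>I. Z i \<omega>))\<^sup>2) = (\<Sum>i\<in>I. expectation (\<lambda>\<omega>. (norm (Z i \<omega>))\<^sup>2))"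
proof -
  have expand: "(norm (\<Sum>i\<in>I. Z i \<omega>))\<^sup>2 = (\<Sum>i\<in>I. \<Sum>j\<in>I. Z i \<omega> \<bullet> Z j \<omega>)" for \<omega>
    unfolding power2_norm_eq_inner inner_sum_left inner_sum_right by (rule sum.swap)
  have coord: "integrable M (\<lambda>\<omega>. (Z i \<omega> \<bullet> b) * (Z j \<omega> \<bullet> b))" (is ?int)
    "expectation (\<lambda>\<omega>. (Z i \<omega> \<bullet> b) * (Z j \<omega> \<bullet> b)) = 0" (is ?mean)
    if "i \<in> I" "j \<in> I" "i \<noteq> j" for i j b
  proof -
    have ind: "indep_vars (\<lambda>_. borel) (\<lambda>k \<omega>. Z k \<omega> \<bullet> b) {i, j}"
      using that by (intro indep_vars_compose2[OF indep_vars_subset[OF indep]]) auto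
    have int': "\<And>k. k \<in> {i, j} \<Longrightarrow> integrable M (\<lambda>\<omega>. Z k \<omega> \<bullet> b)"
      using int that by auto
    show ?int
      using indep_vars_integrable[OF _ ind int'] that by simp
    have "expectation (\<lambda>\<omega>. Z i \<omega> \<bullet> b) = 0"
      using int mean that by simp
    then show ?mean
      using indep_vars_lebesgue_integral[OF _ ind int'] that by simp
  qed
  have pair: "integrable M (\<lambda>\<omega>. Z i \<omega> \<bullet> Z j \<omega>)"
    "expectation (\<lambda>\<omega>. Z i \<omega> \<bullet> Z j \<omega>)
      = (if i = j then expectation (\<lambda>\<omega>. (norm (Z i \<omega>))\<^sup>2) else 0)"
    if "i \<in> I" "j \<in> I" for i j
  proof -
    have "integrable M (\<lambda>\<omega>. Z i \<omega> \<bullet> Z j \<omega>) \<and> expectation (\<lambda>\<omega>. Z i \<omega> \<bullet> Z j \<omega>)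
      = (if i = j then expectation (\<lambda>\<omega>. (norm (Z i \<omega>))\<^sup>2) else 0)"
    proof (cases "i = j")
      case True
      with square[OF that(1)] show ?thesis
        by (simp add: dot_square_norm)
    next
      case False
      with coord[OF that] show ?thesis
        unfolding euclidean_inner[of "Z i _" "Z j _"] by simp
    qed
    then show "integrable M (\<lambda>\<omega>. Z i \<omega> \<bullet> Z j \<omega>)"
      and "expectation (\<lambda>\<omega>. Z i \<omega> \<bullet> Z j \<omega>)
        = (if i = j then expectation (\<lambda>\<omega>. (norm (Z i \<omega>))\<^sup>2) else 0)"
      by auto
  qed
  show "integrable M (\<lambda>\<omega>. (norm (\<Sum>i\<in>I. Z i \<omega>))\<^sup>2)"
    unfolding expand by (intro Bochner_Integration.integrable_sum pair)
  show "expectation (\<lambda>\<omega>. (norm (\<Sum>i\<in>I. Z i \<omega>))\<^sup>2) = (\<Sum>i\<in>I. expectation (\<lambda>\<omega>. (norm (Z i \<omega>))\<^sup>2))"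
    unfolding expand
  proof -
    have "expectation (\<lambda>\<omega>. \<Sum>i\<in>I. \<Sum>j\<in>I. Z i \<omega> \<bullet> Z j \<omega>)
        = (\<Sum>i\<in>I. \<Sum>j\<in>I. expectation (\<lambda>\<omega>. Z i \<omega> \<bullet> Z j \<omega>))"
      by (simp add: pair(1))
    also have "\<dots> = (\<Sum>i\<in>I. \<Sum>j\<in>I. if i = j then expectation (\<lambda>\<omega>. (norm (Z i \<omega>))\<^sup>2) else 0)"
      by (intro sum.cong refl pair)
    also have "\<dots> = (\<Sum>i\<in>I. expectation (\<lambda>\<omega>. (norm (Z i \<omega>))\<^sup>2))"
      using \<open>finite I\<close> by simp
    finally show "expectation (\<lambda>\<omega>. \<Sum>i\<in>I. \<Sum>j\<in>I. Z i \<omega> \<bullet> Z j \<omega>)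
        = (\<Sum>i\<in>I. expectation (\<lambda>\<omega>. (norm (Z i \<omega>))\<^sup>2))" .
  qed
qed

text \<open>Averaging divides the variance bound by \<open>S\<close>, and the first moment is at
  most the root of the second. The point \<open>x\<close> is deterministic here; random iterates are
  treated in \<open>gradient_error\<close>.\<close>

lemma (in prob_space) minibatch_error:
  fixes \<xi> :: "nat \<Rightarrow> 'a \<Rightarrow> 's" and f :: "'b::euclidean_space \<Rightarrow> 's \<Rightarrow> real"
  assumes unbiased: "unbiased_gradients D f F"
    and variance: "variance_bounded_gradients G0 G1 D f F"
    and "0 \<le> G0" "0 \<le> G1" "0 < S"
    and meas: "\<And>i. i < S \<Longrightarrow> \<xi> i \<in> measurable M D"
    and distr: "\<And>i. i < S \<Longrightarrow> distr M D (\<xi> i) = D"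
    and indep: "indep_vars (\<lambda>_. D) \<xi> {..<S}"
  shows "integrable M (\<lambda>\<omega>. norm (minibatch_grad f S x (\<lambda>i. \<xi> i \<omega>) - gradient F x))"
    and "expectation (\<lambda>\<omega>. norm (minibatch_grad f S x (\<lambda>i. \<xi> i \<omega>) - gradient F x))
      \<le> (G0 + G1 * norm (gradient F x)) / sqrt (real S)"
proof -
  define Y where "Y s = stoch_grad f x s - gradient F x" for s
  define v where "v = G0\<^sup>2 + G1\<^sup>2 * (norm (gradient F x))\<^sup>2"
  define e where "e \<omega> = minibatch_grad f S x (\<lambda>i. \<xi> i \<omega>) - gradient F x" for \<omega>
  have grad: "integrable D (stoch_grad f x)" "(\<integral>s. stoch_grad f x s \<partial>D) = gradient F x"
    using unbiased by (auto simp: unbiased_gradients_def)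
  \<comment> \<open>\<open>D\<close> is the law of sample number 0, which exists because
    \<open>0 < S\<close>. Total mass 1 is what centres \<open>Y\<close>, since a constant is
    subtracted.\<close>
  have "prob_space D"
    using prob_space_distr[OF meas[of 0]] distr[of 0] \<open>0 < S\<close> by simp
  then interpret D: prob_space D .
  have Y: "integrable D Y" "(\<integral>s. Y s \<partial>D) = 0" "integrable D (\<lambda>s. (norm (Y s))\<^sup>2)"
    "(\<integral>s. (norm (Y s))\<^sup>2 \<partial>D) \<le> v"
    using grad variance
    by (auto simp: Y_def[abs_def] v_def variance_bounded_gradients_def D.prob_space)
  have Ym: "Y \<in> borel_measurable D"
    using Y(1) by auto
  have int_\<xi>: "integrable M (\<lambda>\<omega>. h (\<xi> i \<omega>))" (is ?A)
    and expectation_\<xi>: "expectation (\<lambda>\<omega>. h (\<xi> i \<omega>)) = (\<integral>s. h s \<partial>D)" (is ?B)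
    if "i < S" "integrable D h" for i and h :: "'s \<Rightarrow> 'c::euclidean_space"
    using integrable_distr_eq[OF meas[OF that(1)], of h] integral_distr[OF meas[OF that(1)], of h]
      distr[OF that(1)] that(2) by auto
  have indep_Y: "indep_vars (\<lambda>_. borel) (\<lambda>i \<omega>. Y (\<xi> i \<omega>)) {..<S}"
    by (rule indep_vars_compose2[OF indep Ym])
  have e_eq: "e \<omega> = (\<Sum>i<S. Y (\<xi> i \<omega>)) /\<^sub>R real S" for \<omega>
    using \<open>0 < S\<close>
    by (simp add: e_def minibatch_grad_def Y_def sum_subtractf scaleR_diff_right sum_constant_scaleR)
  have sq: "(norm (e \<omega>))\<^sup>2 = (norm (\<Sum>i<S. Y (\<xi> i \<omega>)))\<^sup>2 / (real S)\<^sup>2" for \<omega>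
    by (simp add: e_eq power_mult_distrib power_inverse divide_inverse mult.commute)
  have moment: "integrable M (\<lambda>\<omega>. (norm (\<Sum>i<S. Y (\<xi> i \<omega>)))\<^sup>2)"
    "expectation (\<lambda>\<omega>. (norm (\<Sum>i<S. Y (\<xi> i \<omega>)))\<^sup>2) = (\<Sum>i<S. (\<integral>s. (norm (Y s))\<^sup>2 \<partial>D))"
    using second_moment_sum_indep_centered[OF _ indep_Y] int_\<xi>[OF _ Y(1)] expectation_\<xi>[OF _ Y(1)]
      int_\<xi>[OF _ Y(3)] expectation_\<xi>[OF _ Y(3)] Y(2) by simp_all
  have int_sq: "integrable M (\<lambda>\<omega>. (norm (e \<omega>))\<^sup>2)"
    unfolding sq using moment(1) by simp
  have Y\<xi>: "(\<lambda>\<omega>. Y (\<xi> i \<omega>)) \<in> borel_measurable M" if "i < S" for i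
    using measurable_compose[OF meas[OF that] Ym] .
  have "(\<lambda>\<omega>. \<Sum>i<S. Y (\<xi> i \<omega>)) \<in> borel_measurable M"
    by (rule borel_measurable_sum) (simp add: Y\<xi>)
  then have em: "(\<lambda>\<omega>. norm (e \<omega>)) \<in> borel_measurable M"
    unfolding e_eq by measurable
  have "expectation (\<lambda>\<omega>. (norm (e \<omega>))\<^sup>2) \<le> real S * v / (real S)\<^sup>2"
    unfolding sq using Y(4) by (simp add: moment divide_right_mono mult_left_mono)
  then have "expectation (\<lambda>\<omega>. (norm (e \<omega>))\<^sup>2) \<le> v / real S"
    using \<open>0 < S\<close> by (simp add: power2_eq_square)
  \<comment> \<open>After the square root this makes the bound affine in the gradient norm, so that
    at a random point its expectation involves only the mean gradient norm.\<close>
  moreover have "v \<le> (G0 + G1 * norm (gradient F x))\<^sup>2"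
    using \<open>0 \<le> G0\<close> \<open>0 \<le> G1\<close> by (simp add: v_def power2_sum power_mult_distrib)
  ultimately have "sqrt (expectation (\<lambda>\<omega>. (norm (e \<omega>))\<^sup>2))
      \<le> sqrt ((G0 + G1 * norm (gradient F x))\<^sup>2 / real S)"
    by (meson divide_right_mono of_nat_0_le_iff order_trans real_sqrt_le_mono)
  also have "\<dots> = (G0 + G1 * norm (gradient F x)) / sqrt (real S)"
    using \<open>0 \<le> G0\<close> \<open>0 \<le> G1\<close> by (simp add: real_sqrt_divide)
  finally show "expectation (\<lambda>\<omega>. norm (minibatch_grad f S x (\<lambda>i. \<xi> i \<omega>) - gradient F x))
      \<le> (G0 + G1 * norm (gradient F x)) / sqrt (real S)"
    using expectation_le_sqrt_second_moment[OF em int_sq] by (simp add: e_def)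
  show "integrable M (\<lambda>\<omega>. norm (minibatch_grad f S x (\<lambda>i. \<xi> i \<omega>) - gradient F x))"
    using square_integrable_imp_integrable[OF em int_sq] by (simp add: e_def)
qed

section \<open>Independence of sigma-algebras and evaluation at a random index\<close>

lemma (in prob_space) indep_set_commute: "indep_set A B \<Longrightarrow> indep_set B A"
  unfolding indep_sets2_eq by (metis Int_commute mult.commute)

text \<open>The sigma-algebras generated by \<open>X\<close> and \<open>Y\<close> lie inside those
  of \<open>G\<close> and \<open>H\<close>, so independence is inherited.\<close>

lemma (in prob_space) indep_var_of_indep_set:
  assumes X: "X \<in> measurable G N1" "space G = space M"
    and Y: "Y \<in> measurable H N2" "space H = space M"
    and indep: "indep_set (sets G) (sets H)"
  shows "indep_var N1 X N2 Y"
  unfolding indep_var_eq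
proof (intro conjI)
  have sub: "subalgebra M G" "subalgebra M H"
    using X(2) Y(2) indep by (auto simp: subalgebra_def dest: indep_setD_ev1 indep_setD_ev2)
  show "random_variable N1 X" "random_variable N2 Y"
    using measurable_from_subalg[OF sub(1) X(1)] measurable_from_subalg[OF sub(2) Y(1)] .
  have "sigma_sets (space M) {X -` A \<inter> space M | A. A \<in> sets N1} \<subseteq> sets G"
    using measurable_sets[OF X(1)] unfolding X(2)[symmetric] by (intro sets.sigma_sets_subset) auto
  moreover have "sigma_sets (space M) {Y -` A \<inter> space M | A. A \<in> sets N2} \<subseteq> sets H"
    using measurable_sets[OF Y(1)] unfolding Y(2)[symmetric] by (intro sets.sigma_sets_subset) auto
  ultimately show "indep_set (sigma_sets (space M) {X -` A \<inter> space M |A. A \<in> sets N1})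
      (sigma_sets (space M) {Y -` A \<inter> space M |A. A \<in> sets N2})"
    using indep unfolding indep_sets2_eq by blast
qed

text \<open>\<^const>\<open>prob_space.indep_var\<close> forces both variables to take values in the same type.\<close>

lemma (in prob_space) distr_pair_of_indep_set:
  assumes X: "X \<in> measurable G N1" "space G = space M"
    and Y: "Y \<in> measurable H N2" "space H = space M"
    and indep: "indep_set (sets G) (sets H)"
  shows "distr M (N1 \<Otimes>\<^sub>M N2) (\<lambda>\<omega>. (X \<omega>, Y \<omega>)) = distr M N1 X \<Otimes>\<^sub>M distr M N2 Y"
proof -
  have sub: "subalgebra M G" "subalgebra M H"
    using X(2) Y(2) indep by (auto simp: subalgebra_def dest: indep_setD_ev1 indep_setD_ev2)
  have X_rv: "random_variable N1 X" and Y_rv: "random_variable N2 Y"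
    using measurable_from_subalg[OF sub(1) X(1)] measurable_from_subalg[OF sub(2) Y(1)] .
  interpret PX: prob_space "distr M N1 X"
    by (rule prob_space_distr[OF X_rv])
  interpret PY: prob_space "distr M N2 Y"
    by (rule prob_space_distr[OF Y_rv])
  have "distr M N1 X \<Otimes>\<^sub>M distr M N2 Y = distr M (N1 \<Otimes>\<^sub>M N2) (\<lambda>\<omega>. (X \<omega>, Y \<omega>))"
  proof (rule pair_measure_eqI)
    fix A B assume "A \<in> sets (distr M N1 X)" "B \<in> sets (distr M N2 Y)"
    then have AB: "A \<in> sets N1" "B \<in> sets N2"
      by simp_all
    have "(\<lambda>\<omega>. (X \<omega>, Y \<omega>)) -` (A \<times> B) \<inter> space M = (X -` A \<inter> space M) \<inter> (Y -` B \<inter> space M)"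
      by auto
    moreover have "prob ((X -` A \<inter> space M) \<inter> (Y -` B \<inter> space M))
        = prob (X -` A \<inter> space M) * prob (Y -` B \<inter> space M)"
      using measurable_sets[OF X(1) AB(1)] measurable_sets[OF Y(1) AB(2)] X(2) Y(2)
      by (intro indep_setD[OF indep]) auto
    ultimately show "emeasure (distr M N1 X) A * emeasure (distr M N2 Y) B
        = emeasure (distr M (N1 \<Otimes>\<^sub>M N2) (\<lambda>\<omega>. (X \<omega>, Y \<omega>))) (A \<times> B)"
      using AB X_rv Y_rv by (simp add: emeasure_distr emeasure_eq_measure ennreal_mult)
  qed (simp_all add: PX.sigma_finite_measure PY.sigma_finite_measure cong: sets_pair_measure_cong)
  then show ?thesis ..
qed

text \<open>Split according to the value of \<open>tbar\<close>. The indicator of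
  \<open>tbar = t\<close> has mean \<open>1 / T\<close> and is independent of \<open>h t\<close>,
  which is measurable for \<open>G\<close>; each product therefore integrates to
  \<open>expectation (h t) / T\<close>.\<close>

lemma (in prob_space) uniform_index_expectation:
  fixes h :: "nat \<Rightarrow> 'a \<Rightarrow> real"
  assumes tbar: "tbar \<in> measurable M (count_space {..<T})"
    and uniform: "distr M (count_space {..<T}) tbar = uniform_count_measure {..<T}"
    and G: "subalgebra M G"
    and indep: "indep_set (sets (vimage_algebra (space M) tbar (count_space {..<T}))) (sets G)"
    and h: "\<And>t. t < T \<Longrightarrow> h t \<in> borel_measurable G" "\<And>t. t < T \<Longrightarrow> integrable M (h t)"
  shows "integrable M (\<lambda>\<omega>. h (tbar \<omega>) \<omega>)"
    and "expectation (\<lambda>\<omega>. h (tbar \<omega>) \<omega>) = (\<Sum>t<T. expectation (h t)) / real T"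
proof -
  define I :: "nat \<Rightarrow> 'a \<Rightarrow> real" where "I t \<omega> = indicator {t} (tbar \<omega>)" for t \<omega>
  have decomp: "h (tbar \<omega>) \<omega> = (\<Sum>t<T. I t \<omega> * h t \<omega>)" if "\<omega> \<in> space M" for \<omega>
  proof -
    have "tbar \<omega> < T"
      using measurable_space[OF tbar that] by simp
    then show ?thesis
      by (simp add: I_def indicator_def if_distrib[of "\<lambda>c. c * _"] cong: if_cong)
  qed
  have ind: "indep_var borel (I t) borel (h t)" if "t < T" for t
  proof -
    have "tbar \<in> measurable (vimage_algebra (space M) tbar (count_space {..<T})) (count_space {..<T})"
      using measurable_space[OF tbar] by (intro measurable_vimage_algebra1) auto
    from measurable_compose[OF this, of "indicator {t} :: nat \<Rightarrow> real" borel]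
    have "I t \<in> borel_measurable (vimage_algebra (space M) tbar (count_space {..<T}))"
      by (simp add: I_def[abs_def])
    then show ?thesis
      using G indep h(1)[OF that] by (intro indep_var_of_indep_set) (auto simp: subalgebra_def)
  qed
  have I: "integrable M (I t)" "expectation (I t) = 1 / real T" if "t < T" for t
  proof -
    have m: "(indicator {t} :: nat \<Rightarrow> real) \<in> borel_measurable (count_space {..<T})"
      by simp
    have "I t \<in> borel_measurable M"
      unfolding I_def[abs_def] by (rule measurable_compose[OF tbar m])
    then show "integrable M (I t)"
      by (rule integrable_const_bound[of _ 1, rotated]) (simp add: I_def)
    have "expectation (I t) = (\<integral>k. indicator {t} k \<partial>uniform_count_measure {..<T})"
      unfolding I_def[abs_def] uniform[symmetric] by (rule integral_distr[OF tbar m, symmetric])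
    also have "\<dots> = 1 / real T"
      using that by (simp add: measure_uniform_count_measure space_uniform_count_measure)
    finally show "expectation (I t) = 1 / real T" .
  qed
  have prod: "integrable M (\<lambda>\<omega>. I t \<omega> * h t \<omega>)"
    "expectation (\<lambda>\<omega>. I t \<omega> * h t \<omega>) = expectation (h t) / real T" if "t < T" for t
    using indep_var_integrable[OF ind I(1) h(2)] indep_var_lebesgue_integral[OF ind I(1) h(2)] I(2) that
    by auto
  have "integrable M (\<lambda>\<omega>. \<Sum>t<T. I t \<omega> * h t \<omega>)"
    using prod by (intro Bochner_Integration.integrable_sum) simp
  then show "integrable M (\<lambda>\<omega>. h (tbar \<omega>) \<omega>)"
    by (subst Bochner_Integration.integrable_cong[OF refl decomp])
  have "expectation (\<lambda>\<omega>. h (tbar \<omega>) \<omega>) = expectation (\<lambda>\<omega>. \<Sum>t<T. I t \<omega> * h t \<omega>)"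
    by (rule Bochner_Integration.integral_cong[OF refl decomp])
  also have "\<dots> = (\<Sum>t<T. expectation (h t) / real T)"
    using prod by (simp add: Bochner_Integration.integral_sum)
  finally show "expectation (\<lambda>\<omega>. h (tbar \<omega>) \<omega>) = (\<Sum>t<T. expectation (h t)) / real T"
    by (simp add: sum_divide_distrib)
qed

section \<open>The random run: iterates, gradient error and expected decrease\<close>

context trust_region_method
begin

lemma x_random_variable: "t \<le> T \<Longrightarrow> x t \<in> borel_measurable M"
  using measurable_from_subalg[OF subalgebra x_adapted] .

lemma iterate_distance:
  assumes "t \<le> T" "\<omega> \<in> space M"
  shows "norm (x t \<omega> - x0) \<le> (\<Sum>k<t. \<Delta> k)"
  using assms(1)
proof (induction t)
  case 0
  with x_init[OF assms(2)] show ?case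
    by simp
next
  case (Suc t)
  then have "norm (d (Suc t) \<omega>) \<le> \<Delta> t"
    using d_solves[OF _ assms(2), of t] by (simp add: is_arg_min_def)
  moreover have "norm (x (Suc t) \<omega> - x0) \<le> norm (x t \<omega> - x0) + norm (d (Suc t) \<omega>)"
    using x_step[OF _ assms(2), of t] Suc.prems norm_triangle_ineq[of "x t \<omega> - x0" "d (Suc t) \<omega>"]
    by (simp add: algebra_simps)
  ultimately show ?case
    using Suc by simp
qed

text \<open>All iterates lie in a fixed ball, so no moment assumption is needed.\<close>

lemma integrable_continuous_iterate:
  fixes h :: "real^'n \<Rightarrow> real"
  assumes "continuous_on UNIV h" "t \<le> T"
  shows "integrable M (\<lambda>\<omega>. h (x t \<omega>))"
proof -
  define K where "K = cball x0 (\<Sum>k<t. \<Delta> k)"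
  have "bounded (h ` K)"
    using assms(1) by (intro compact_imp_bounded compact_continuous_image)
      (auto simp: K_def intro: continuous_on_subset)
  then obtain b where b: "\<And>y. y \<in> K \<Longrightarrow> norm (h y) \<le> b"
    by (auto simp: bounded_iff)
  have "x t \<omega> \<in> K" if "\<omega> \<in> space M" for \<omega>
    using iterate_distance[OF assms(2) that] by (simp add: K_def dist_norm norm_minus_commute)
  with b have "AE \<omega> in M. norm (h (x t \<omega>)) \<le> b"
    by (intro AE_I2) auto
  moreover have "(\<lambda>\<omega>. h (x t \<omega>)) \<in> borel_measurable M"
    using measurable_compose[OF x_random_variable[OF assms(2)]
        borel_measurable_continuous_onI[OF assms(1)]] .
  ultimately show ?thesis
    by (rule integrable_const_bound)
qed

text \<open>The restriction to \<open>{..<S}\<close> makes this a point of the product space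
  \<open>PiM {..<S}\<close>; it is the variable whose generated sigma-algebra appears in
  \<open>batch_fresh\<close>.\<close>

definition batch :: "nat \<Rightarrow> 'w \<Rightarrow> nat \<Rightarrow> 's" where
  "batch t \<omega> = (\<lambda>i\<in>{..<S}. \<xi> t i \<omega>)"

lemma sample_random_variable: "t < T \<Longrightarrow> i < S \<Longrightarrow> \<xi> t i \<in> measurable M D"
  using measurable_from_subalg[OF subalgebra \<xi>_adapted] .

lemma batch_random_variable: "t < T \<Longrightarrow> batch t \<in> measurable M (PiM {..<S} (\<lambda>_. D))"
  unfolding batch_def by (intro measurable_restrict sample_random_variable) auto

text \<open>The iterate is measurable for the past and the batch is independent of the past. The
  resulting product law replaces conditioning on the past by iterated integration.\<close>

lemma distr_iterate_batch:
  assumes "t < T"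
  defines "P \<equiv> PiM {..<S} (\<lambda>_. D)"
  shows "distr M (borel \<Otimes>\<^sub>M P) (\<lambda>\<omega>. (x t \<omega>, batch t \<omega>)) = distr M borel (x t) \<Otimes>\<^sub>M distr M P (batch t)"
proof (rule distr_pair_of_indep_set)
  show "x t \<in> borel_measurable (\<F> t)"
    using assms(1) by (intro x_adapted) simp
  show "batch t \<in> measurable (vimage_algebra (space M) (batch t) P) P"
    using measurable_space[OF batch_random_variable[OF assms(1)]]
    by (intro measurable_vimage_algebra1) (auto simp: P_def)
  show "indep_set (sets (\<F> t)) (sets (vimage_algebra (space M) (batch t) P))"
    using indep_set_commute[OF batch_fresh[OF assms(1)]] by (simp add: batch_def[abs_def] P_def)
qed (simp_all add: space_F)

lemma minibatch_grad_batch: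
  "minibatch_grad f S y (batch t \<omega>) = minibatch_grad f S y (\<lambda>i. \<xi> t i \<omega>)"
  by (simp add: minibatch_grad_def batch_def)

lemma gradient_error:
  assumes objective: "stochastic_objective D f F"
    and smooth: "L0L1_smooth L0 L1 F" "0 \<le> L1"
    and unbiased: "unbiased_gradients D f F"
    and variance: "variance_bounded_gradients G0 G1 D f F" "0 \<le> G0" "0 \<le> G1"
    and "0 < S" "t < T"
  defines "e \<equiv> \<lambda>\<omega>. norm (minibatch_grad f S (x t \<omega>) (\<lambda>i. \<xi> t i \<omega>) - gradient F (x t \<omega>))"
  shows "integrable M e"
    and "expectation e \<le> (G0 + G1 * expectation (\<lambda>\<omega>. norm (gradient F (x t \<omega>)))) / sqrt (real S)"
proof -
  interpret objective: stochastic_objective D f F by fact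
  let ?P = "PiM {..<S} (\<lambda>_. D)"
  define \<psi> where "\<psi> p = norm (minibatch_grad f S (fst p) (snd p) - gradient F (fst p))" for p
  define b where "b y = (G0 + G1 * norm (gradient F y)) / sqrt (real S)" for y
  have cont: "continuous_on UNIV (gradient F)"
    using L0L1_smooth_continuous_gradient[OF smooth] .
  have grad_m: "gradient F \<in> borel_measurable borel"
    by (rule borel_measurable_continuous_onI[OF cont])
  have "(\<lambda>p. stoch_grad f (fst p) (snd p i)) \<in> borel_measurable (borel \<Otimes>\<^sub>M ?P)" if "i < S" for i
    using measurable_compose[of "\<lambda>p. (fst p, snd p i)" "borel \<Otimes>\<^sub>M ?P" "borel \<Otimes>\<^sub>M D",
        OF _ objective.stoch_grad_measurable] that by simp
  then have "(\<lambda>p. \<Sum>i<S. stoch_grad f (fst p) (snd p i)) \<in> borel_measurable (borel \<Otimes>\<^sub>M ?P)"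
    by (intro borel_measurable_sum) simp
  then have \<psi>_m [measurable]: "\<psi> \<in> borel_measurable (borel \<Otimes>\<^sub>M ?P)"
    unfolding \<psi>_def[abs_def] minibatch_grad_def using grad_m by measurable
  have x_m [measurable]: "x t \<in> borel_measurable M"
    and batch_m [measurable]: "batch t \<in> measurable M ?P"
    using \<open>t < T\<close> by (simp_all add: x_random_variable batch_random_variable)
  have e_eq: "e \<omega> = \<psi> (x t \<omega>, batch t \<omega>)" for \<omega>
    by (simp add: e_def \<psi>_def minibatch_grad_batch)
  have e_m: "e \<in> borel_measurable M"
    unfolding e_eq[abs_def] by measurable
  have b_nonneg: "0 \<le> b y" for y
    using variance by (simp add: b_def)
  have b_int: "integrable M (\<lambda>\<omega>. b (x t \<omega>))"
    using \<open>t < T\<close> \<open>0 < S\<close> by (intro integrable_continuous_iterate)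
      (auto simp: b_def[abs_def] intro!: continuous_intros cont)
  \<comment> \<open>With the iterate frozen at \<open>y\<close> only the batch is random, so the
    fixed-point estimate \<open>minibatch_error\<close> applies.\<close>
  have inner_le: "(\<integral>\<^sup>+\<omega>. ennreal (\<psi> (y, batch t \<omega>)) \<partial>M) \<le> ennreal (b y)" for y
  proof -
    note err = minibatch_error[OF unbiased variance \<open>0 < S\<close> sample_random_variable[OF \<open>t < T\<close>]
        batch_distr[OF \<open>t < T\<close>] batch_indep[OF \<open>t < T\<close>], of y]
    have "(\<integral>\<^sup>+\<omega>. ennreal (\<psi> (y, batch t \<omega>)) \<partial>M)
        = ennreal (expectation (\<lambda>\<omega>. norm (minibatch_grad f S y (\<lambda>i. \<xi> t i \<omega>) - gradient F y)))"
      using nn_integral_eq_integral[OF err(1)] by (simp add: \<psi>_def minibatch_grad_batch)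
    also have "\<dots> \<le> ennreal (b y)"
      using err(2) by (simp add: b_def ennreal_leI)
    finally show ?thesis .
  qed
  interpret Q: prob_space "distr M ?P (batch t)"
    by (rule prob_space_distr) measurable
  \<comment> \<open>Tonelli under the product law: the batch is integrated first, then the iterate.
    Working with nonnegative integrals yields integrability of \<open>e\<close> from the finite
    bound.\<close>
  have "(\<integral>\<^sup>+\<omega>. ennreal (e \<omega>) \<partial>M) = (\<integral>\<^sup>+p. ennreal (\<psi> p) \<partial>distr M (borel \<Otimes>\<^sub>M ?P) (\<lambda>\<omega>. (x t \<omega>, batch t \<omega>)))"
    by (subst nn_integral_distr) (auto simp: e_eq)
  also have "\<dots> = (\<integral>\<^sup>+p. ennreal (\<psi> p) \<partial>(distr M borel (x t) \<Otimes>\<^sub>M distr M ?P (batch t)))"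
    by (simp add: distr_iterate_batch[OF \<open>t < T\<close>])
  also have "\<dots> = (\<integral>\<^sup>+y. \<integral>\<^sup>+z. ennreal (\<psi> (y, z)) \<partial>distr M ?P (batch t) \<partial>distr M borel (x t))"
    by (subst Q.nn_integral_fst[symmetric]) auto
  also have "\<dots> = (\<integral>\<^sup>+y. \<integral>\<^sup>+\<omega>. ennreal (\<psi> (y, batch t \<omega>)) \<partial>M \<partial>distr M borel (x t))"
    by (intro nn_integral_cong nn_integral_distr) measurable
  also have "\<dots> \<le> (\<integral>\<^sup>+y. ennreal (b y) \<partial>distr M borel (x t))"
    by (intro nn_integral_mono inner_le)
  also have "\<dots> = (\<integral>\<^sup>+\<omega>. ennreal (b (x t \<omega>)) \<partial>M)"
    using grad_m by (intro nn_integral_distr) (auto simp: b_def[abs_def])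
  also have "\<dots> = ennreal (expectation (\<lambda>\<omega>. b (x t \<omega>)))"
    using b_nonneg by (intro nn_integral_eq_integral b_int) auto
  finally have e_le: "(\<integral>\<^sup>+\<omega>. ennreal (e \<omega>) \<partial>M) \<le> ennreal (expectation (\<lambda>\<omega>. b (x t \<omega>)))" .
  have e_nonneg: "0 \<le> e \<omega>" for \<omega>
    by (simp add: e_def)
  show e_int: "integrable M e"
    using e_le e_nonneg by (intro integrableI_nonneg e_m) (auto intro: le_less_trans)
  have "ennreal (expectation e) \<le> ennreal (expectation (\<lambda>\<omega>. b (x t \<omega>)))"
    using e_le e_nonneg nn_integral_eq_integral[OF e_int] by simp
  then have "expectation e \<le> expectation (\<lambda>\<omega>. b (x t \<omega>))"
    using b_nonneg by (subst (asm) ennreal_le_iff) (auto intro: integral_nonneg_AE)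
  also have "\<dots> = (G0 + G1 * expectation (\<lambda>\<omega>. norm (gradient F (x t \<omega>)))) / sqrt (real S)"
    using integrable_continuous_iterate[OF continuous_on_norm[OF cont], of t] \<open>t < T\<close>
    by (simp add: b_def prob_space)
  finally show "expectation e \<le> (G0 + G1 * expectation (\<lambda>\<omega>. norm (gradient F (x t \<omega>)))) / sqrt (real S)" .
qed

text \<open>Takes expectations in \<open>trust_region_step_decrease\<close>. Every term there is
  affine in the gradient norm or in the error, so the result is a scalar recursion involving only
  \<open>N\<close>.\<close>

lemma expected_decrease:
  assumes objective: "stochastic_objective D f F"
    and smooth: "L0L1_smooth L0 L1 F" "0 \<le> L0" "0 \<le> L1" "L1 * \<Delta> t \<le> 1"
    and unbiased: "unbiased_gradients D f F"
    and variance: "variance_bounded_gradients G0 G1 D f F" "0 \<le> G0" "0 \<le> G1"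
    and "0 < S" "t < T"
    and B: "\<And>\<omega>. \<omega> \<in> space M \<Longrightarrow> onorm ((*v) (B t \<omega>)) \<le> \<beta>"
    and "0 \<le> \<Delta> t"
  defines "N \<equiv> expectation (\<lambda>\<omega>. norm (gradient F (x t \<omega>)))"
  shows "expectation (\<lambda>\<omega>. F (x (Suc t) \<omega>)) \<le> expectation (\<lambda>\<omega>. F (x t \<omega>)) - \<Delta> t * N
    + 2 * \<Delta> t * ((G0 + G1 * N) / sqrt (real S)) + \<beta> * (\<Delta> t)\<^sup>2 + (L0 + L1 * N) / 2 * (\<Delta> t)\<^sup>2"
proof -
  define e where "e \<omega> = norm (minibatch_grad f S (x t \<omega>) (\<lambda>i. \<xi> t i \<omega>) - gradient F (x t \<omega>))" for \<omega>
  define n where "n \<omega> = norm (gradient F (x t \<omega>))" for \<omega>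
  have e: "integrable M e" "expectation e \<le> (G0 + G1 * N) / sqrt (real S)"
    using gradient_error[OF objective smooth(1,3) unbiased variance \<open>0 < S\<close> \<open>t < T\<close>]
    by (simp_all add: e_def[abs_def] N_def)
  have "continuous_on UNIV F"
    by (rule L0L1_smooth_continuous[OF smooth(1)])
  then have F: "integrable M (\<lambda>\<omega>. F (x t \<omega>))" "integrable M (\<lambda>\<omega>. F (x (Suc t) \<omega>))"
    using \<open>t < T\<close> by (auto intro: integrable_continuous_iterate)
  have n: "integrable M n"
    unfolding n_def[abs_def] using \<open>t < T\<close> L0L1_smooth_continuous_gradient[OF smooth(1,3)]
    by (intro integrable_continuous_iterate) (auto intro: continuous_intros)
  have "expectation (\<lambda>\<omega>. F (x (Suc t) \<omega>)) \<le> expectation (\<lambda>\<omega>. F (x t \<omega>) - \<Delta> t * n \<omega> + 2 * \<Delta> t * e \<omega>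
    + \<beta> * (\<Delta> t)\<^sup>2 + (L0 + L1 * n \<omega>) / 2 * (\<Delta> t)\<^sup>2)"
  proof (rule integral_mono)
    fix \<omega> assume "\<omega> \<in> space M"
    then show "F (x (Suc t) \<omega>) \<le> F (x t \<omega>) - \<Delta> t * n \<omega> + 2 * \<Delta> t * e \<omega>
        + \<beta> * (\<Delta> t)\<^sup>2 + (L0 + L1 * n \<omega>) / 2 * (\<Delta> t)\<^sup>2"
      using trust_region_step_decrease[OF smooth d_solves[OF \<open>t < T\<close>] B \<open>0 \<le> \<Delta> t\<close>] x_step[OF \<open>t < T\<close>]
      by (simp add: e_def n_def)
  qed (use F n e in auto)
  also have "\<dots> = expectation (\<lambda>\<omega>. F (x t \<omega>)) - \<Delta> t * expectation n + 2 * \<Delta> t * expectation e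
    + \<beta> * (\<Delta> t)\<^sup>2 + (L0 + L1 * expectation n) / 2 * (\<Delta> t)\<^sup>2"
    using F n e by (simp add: prob_space)
  also have "\<dots> \<le> expectation (\<lambda>\<omega>. F (x t \<omega>)) - \<Delta> t * N
    + 2 * \<Delta> t * ((G0 + G1 * N) / sqrt (real S)) + \<beta> * (\<Delta> t)\<^sup>2 + (L0 + L1 * N) / 2 * (\<Delta> t)\<^sup>2"
    using mult_left_mono[OF e(2), of "2 * \<Delta> t"] \<open>0 \<le> \<Delta> t\<close> by (simp add: N_def n_def[abs_def])
  finally show ?thesis .
qed

end

section \<open>Arithmetic of the parameter choices and sample complexity\<close>

lemma step_progress:
  fixes a a' n S r :: real
  assumes constants: "L0 > 0" "L1 \<ge> 0" "G0 > 0" "G1 \<ge> 0" "\<beta> \<ge> 0" "0 < \<epsilon>"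
    and eps: "\<epsilon> * (L1 * G0 + 2 * L0 * G1 + 8 * \<beta> * G1) \<le> 4 * L0 * G0 + 16 * \<beta> * G0"
    and r: "r * (4 * L0 + 16 * \<beta>) = \<epsilon>"
    and S: "64 * G0\<^sup>2 / \<epsilon>\<^sup>2 \<le> S" and "0 \<le> n"
    and step: "a' \<le> a - r * n + 2 * r * ((G0 + G1 * n) / sqrt S) + \<beta> * r\<^sup>2 + (L0 + L1 * n) / 2 * r\<^sup>2"
  shows "r * n \<le> 2 * (a - a') + 3 / 4 * \<epsilon> * r"
proof -
  define N where "N = 4 * L0 + 16 * \<beta>"
  \<comment> \<open>The slope in \<open>n\<close> of the noise bound once \<open>sqrt S\<close> is
    replaced by its lower bound \<open>8 * G0 / \<epsilon>\<close>; the constant part becomes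
    \<open>\<epsilon> / 8\<close>.\<close>
  define q where "q = G1 * \<epsilon> / (8 * G0)"
  have N: "N > 0" "r = \<epsilon> / N"
    using constants r by (auto simp: N_def field_simps)
  then have "r > 0"
    using constants by simp
  have "8 * G0 / \<epsilon> \<le> sqrt S"
    using S by (intro real_le_rsqrt) (simp add: power_divide power_mult_distrib)
  moreover have "0 < 8 * G0 / \<epsilon>"
    using constants by simp
  moreover from calculation have "0 < sqrt S"
    by linarith
  ultimately have "(G0 + G1 * n) / sqrt S \<le> (G0 + G1 * n) / (8 * G0 / \<epsilon>)"
    using constants \<open>0 \<le> n\<close> by (intro divide_left_mono mult_pos_pos) auto
  also have "\<dots> = \<epsilon> / 8 + n * q"
    using constants by (simp add: q_def field_simps)
  finally have noise: "2 * r * ((G0 + G1 * n) / sqrt S) \<le> 2 * r * (\<epsilon> / 8 + n * q)"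
    using \<open>r > 0\<close> by (intro mult_left_mono) auto
  \<comment> \<open>The noise and curvature terms proportional to \<open>n\<close> add up to
    \<open>r * n / 2\<close> times this factor. The first bound on \<open>\<epsilon>\<close> says
    exactly that the factor is at most 1, which leaves half of the decrease
    \<open>r * n\<close>.\<close>
  have "L1 * r + 4 * q = \<epsilon> * (L1 * G0 + 2 * L0 * G1 + 8 * \<beta> * G1) / (N * G0)"
  proof -
    have "L1 * G0 + 2 * L0 * G1 + 8 * \<beta> * G1 = L1 * G0 + G1 * N / 2"
      by (simp add: N_def algebra_simps)
    moreover have "L1 * (\<epsilon> / N) + 4 * q = \<epsilon> * (L1 * G0 + G1 * N / 2) / (N * G0)"
      using N(1) constants(3) by (simp add: q_def field_simps)
    ultimately show ?thesis
      unfolding N(2) by (simp only:)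
  qed
  also have "\<dots> \<le> 1"
  proof -
    have "\<epsilon> * (L1 * G0 + 2 * L0 * G1 + 8 * \<beta> * G1) \<le> N * G0"
      using eps by (simp add: N_def algebra_simps)
    then show ?thesis
      using N(1) constants(3) by (simp add: divide_le_eq_1_pos)
  qed
  finally have "r * n * (L1 * r + 4 * q) \<le> r * n * 1"
    using \<open>r > 0\<close> \<open>0 \<le> n\<close> by (intro mult_left_mono) auto
  \<comment> \<open>This bounds the remaining curvature
    \<open>(\<beta> + L0 / 2) * r\<^sup>2\<close> by \<open>\<epsilon> * r / 8\<close>. With the
    constant noise \<open>\<epsilon> * r / 4\<close> the sum is three eighths, doubled to
    \<open>3 / 4\<close> in the conclusion.\<close>
  moreover have "(8 * \<beta> + 4 * L0) * r \<le> \<epsilon>"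
  proof -
    have "0 \<le> \<beta> * r"
      using constants \<open>r > 0\<close> by simp
    then show ?thesis
      using r by (simp add: algebra_simps)
  qed
  then have "r * ((8 * \<beta> + 4 * L0) * r) \<le> r * \<epsilon>"
    using \<open>r > 0\<close> by (intro mult_left_mono) auto
  ultimately show ?thesis
    using step noise by (simp add: algebra_simps power2_eq_square add_divide_distrib)
qed

lemma nat_ceiling_le_double:
  assumes "1 \<le> (y::real)"
  shows "real (nat \<lceil>y\<rceil>) \<le> 2 * y"
  using assms by linarith

lemma sample_complexity:
  assumes "gap > 0" "l > 0" "b \<ge> 0" "\<sigma> > 0"
  shows "\<forall>\<^sub>F \<eta> in at_right 0.
    real (tr_horizon gap l b \<eta> * tr_batch_size \<sigma> \<eta>) \<le> 32768 * (gap * (l + b) * \<sigma>\<^sup>2 / \<eta> ^ 4)"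
proof -
  define c where "c = 32 * gap * (l + 4 * b)"
  have c: "0 < c" "c \<le> 128 * (gap * (l + b))"
    using assms by (auto simp: c_def algebra_simps intro!: mult_pos_pos add_pos_nonneg)
  \<comment> \<open>Below \<open>sqrt c\<close> and \<open>8 * \<sigma>\<close> both quantities to
    be rounded are at least 1, so each rounding costs at most a factor 2. The constant is then
    \<open>2 * 2 * 64 * 128 = 32768\<close>.\<close>
  have "\<forall>\<^sub>F \<eta> in at_right 0. \<eta> \<in> {0<..<min (sqrt c) (8 * \<sigma>)}"
    using c assms by (intro eventually_at_right_real) simp
  then show ?thesis
  proof eventually_elim
    case (elim \<eta>)
    then have \<eta>: "0 < \<eta>" "\<eta> < sqrt c" "\<eta> < 8 * \<sigma>"
      by auto
    have "\<eta>\<^sup>2 \<le> c"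
      using \<eta> c power_mono[of \<eta> "sqrt c" 2] by simp
    then have T: "real (tr_horizon gap l b \<eta>) \<le> 2 * (c / \<eta>\<^sup>2)"
      unfolding tr_horizon_def c_def[symmetric] using \<eta>(1)
      by (intro nat_ceiling_le_double) simp
    have "\<eta>\<^sup>2 \<le> 64 * \<sigma>\<^sup>2"
      using \<eta> power_mono[of \<eta> "8 * \<sigma>" 2] by (simp add: power_mult_distrib)
    then have S: "real (tr_batch_size \<sigma> \<eta>) \<le> 2 * (64 * \<sigma>\<^sup>2 / \<eta>\<^sup>2)"
      unfolding tr_batch_size_def using \<eta>(1) by (intro nat_ceiling_le_double) simp
    have "real (tr_horizon gap l b \<eta> * tr_batch_size \<sigma> \<eta>)
        \<le> (2 * (c / \<eta>\<^sup>2)) * (2 * (64 * \<sigma>\<^sup>2 / \<eta>\<^sup>2))"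
      unfolding of_nat_mult using T S c by (intro mult_mono) auto
    also have "\<dots> = c * (256 * \<sigma>\<^sup>2 / \<eta> ^ 4)"
      by (simp add: field_simps power_numeral_reduce)
    also have "\<dots> \<le> 128 * (gap * (l + b)) * (256 * \<sigma>\<^sup>2 / \<eta> ^ 4)"
      using c \<eta> by (intro mult_right_mono) auto
    finally show ?case
      by simp
  qed
qed

theorem theorem1:
  fixes F :: "real^'n \<Rightarrow> real"
    and f :: "real^'n \<Rightarrow> 's \<Rightarrow> real"
    and D :: "'s measure"
    and M :: "'w measure"
    and \<F> :: "nat \<Rightarrow> 'w measure"
    and x0 :: "real^'n"
    and S T :: nat
    and \<Delta> :: "nat \<Rightarrow> real"
    and B :: "nat \<Rightarrow> 'w \<Rightarrow> real^'n^'n"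
    and \<xi> :: "nat \<Rightarrow> nat \<Rightarrow> 'w \<Rightarrow> 's"
    and x d :: "nat \<Rightarrow> 'w \<Rightarrow> real^'n"
    and tbar :: "'w \<Rightarrow> nat"
    and L0 L1 G0 G1 \<beta> \<epsilon> \<Delta>\<^sub>F :: real
  assumes objective: "stochastic_objective D f F"
    and bounded_below: "bdd_below (range F)"
    and constants: "L0 > 0" "L1 \<ge> 0" "G0 > 0" "G1 \<ge> 0" "\<beta> \<ge> 0"
    and smooth: "L0L1_smooth L0 L1 F"
    and unbiased: "unbiased_gradients D f F"
    and variance: "variance_bounded_gradients G0 G1 D f F"
    and gap: "\<Delta>\<^sub>F = F x0 - (INF y. F y)" "\<Delta>\<^sub>F > 0"
    and eps_pos: "0 < \<epsilon>"
    (* extended reals: a fraction with zero denominator is infinite *)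
    and eps_le: "ereal \<epsilon> \<le> min
          (ereal (4 * L0 * G0 + 16 * \<beta> * G0) / ereal (L1 * G0 + 2 * L0 * G1 + 8 * \<beta> * G1))
          (ereal (4 * L0 + 16 * \<beta>) / ereal L1)"
    and radius: "\<And>t. \<Delta> t = inverse (4 * L0 + 16 * \<beta>) * \<epsilon>"
    and batch_size: "S = tr_batch_size G0 \<epsilon>"
    and horizon: "T = tr_horizon \<Delta>\<^sub>F L0 \<beta> \<epsilon>"
    and run: "trust_region_method M \<F> D f F x0 S T \<Delta> B \<xi> x d"
    and B_sym: "\<And>t \<omega>. t < T \<Longrightarrow> \<omega> \<in> space M \<Longrightarrow> transpose (B t \<omega>) = B t \<omega>"
    and B_bound: "\<And>t \<omega>. t < T \<Longrightarrow> \<omega> \<in> space M \<Longrightarrow> onorm ((*v) (B t \<omega>)) \<le> \<beta>"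
    and tbar_measurable: "tbar \<in> measurable M (count_space {..<T})"
    and tbar_uniform: "distr M (count_space {..<T}) tbar = uniform_count_measure {..<T}"
    and tbar_indep: "prob_space.indep_set M
          (sets (vimage_algebra (space M) tbar (count_space {..<T}))) (sets (\<F> T))"
  shows "(integrable M (\<lambda>\<omega>. norm (gradient F (x (tbar \<omega>) \<omega>))) \<and>
          (\<integral>\<omega>. norm (gradient F (x (tbar \<omega>) \<omega>)) \<partial>M) \<le> \<epsilon>) \<and>
         (\<exists>C>0. \<forall>gap>0. \<forall>l>0. \<forall>b\<ge>0. \<forall>\<sigma>>0. \<forall>\<^sub>F \<eta> in at_right 0.
            real (tr_horizon gap l b \<eta> * tr_batch_size \<sigma> \<eta>) \<le> C * (gap * (l + b) * \<sigma>\<^sup>2 / \<eta> ^ 4))"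
proof (rule conjI)
  interpret tr: trust_region_method M \<F> D f F x0 S T \<Delta> B \<xi> x d by fact
  define r where "r = \<epsilon> / (4 * L0 + 16 * \<beta>)"
  define a where "a t = tr.expectation (\<lambda>\<omega>. F (x t \<omega>))" for t
  define n where "n t = tr.expectation (\<lambda>\<omega>. norm (gradient F (x t \<omega>)))" for t
  have N: "0 < 4 * L0 + 16 * \<beta>"
    using constants by simp
  have r: "0 < r" "r * (4 * L0 + 16 * \<beta>) = \<epsilon>" and \<Delta>: "\<Delta> t = r" for t
    using N eps_pos radius by (auto simp: r_def field_simps)
  \<comment> \<open>\<open>eps1\<close> controls the terms proportional to the gradient norm;
    \<open>eps2\<close> keeps every step within the smoothness radius, in the form
    \<open>L1 * r \<le> 1\<close>.\<close>
  have eps1: "\<epsilon> * (L1 * G0 + 2 * L0 * G1 + 8 * \<beta> * G1) \<le> 4 * L0 * G0 + 16 * \<beta> * G0"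
    and eps2: "\<epsilon> * L1 \<le> 4 * L0 + 16 * \<beta>"
    using eps_le constants by (auto intro!: ereal_le_divide_imp_mult_le)
  have "L1 * r \<le> 1"
    using eps2 N by (simp add: r_def mult.commute)
  have S: "64 * G0\<^sup>2 / \<epsilon>\<^sup>2 \<le> real S"
    unfolding batch_size tr_batch_size_def by linarith
  moreover have "0 < 64 * G0\<^sup>2 / \<epsilon>\<^sup>2"
    using constants eps_pos by simp
  ultimately have "0 < S"
    using of_nat_0_less_iff[where 'a = real] by (metis less_le_trans)
  have T: "32 * \<Delta>\<^sub>F * (L0 + 4 * \<beta>) / \<epsilon>\<^sup>2 \<le> real T"
    unfolding horizon tr_horizon_def by linarith
  moreover have "0 < 32 * \<Delta>\<^sub>F * (L0 + 4 * \<beta>) / \<epsilon>\<^sup>2"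
    using constants eps_pos gap(2) by (intro divide_pos_pos mult_pos_pos) auto
  ultimately have "0 < T"
    using of_nat_0_less_iff[where 'a = real] by (metis less_le_trans)
  have cont: "continuous_on UNIV (\<lambda>y. norm (gradient F y))"
    using L0L1_smooth_continuous_gradient[OF smooth constants(2)] by (rule continuous_on_norm)
  have cont_F: "continuous_on UNIV F"
    by (rule L0L1_smooth_continuous[OF smooth])
  have n_nonneg: "0 \<le> n t" for t
    unfolding n_def by (intro integral_nonneg_AE) simp
  have "r * n t \<le> 2 * (a t - a (Suc t)) + 3 / 4 * \<epsilon> * r" if "t < T" for t
    using tr.expected_decrease[OF objective smooth _ _ _ unbiased variance _ _ \<open>0 < S\<close> that B_bound[OF that]]
      constants r \<open>L1 * r \<le> 1\<close>
    by (intro step_progress[OF constants eps_pos eps1 r(2) S n_nonneg]) (simp add: \<Delta> a_def n_def)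
  then have "(\<Sum>t<T. r * n t) \<le> (\<Sum>t<T. 2 * (a t - a (Suc t)) + 3 / 4 * \<epsilon> * r)"
    by (intro sum_mono) simp
  \<comment> \<open>Telescoping leaves the total decrease, at most \<open>\<Delta>\<^sub>F\<close>
    because \<open>a 0 = F x0\<close> and the mean of \<open>F\<close> at the last iterate is at
    least the infimum.\<close>
  also have "\<dots> = 2 * (a 0 - a T) + real T * (3 / 4 * \<epsilon> * r)"
    by (simp add: sum.distrib sum_distrib_left[symmetric] sum_lessThan_telescope'
        del: right_diff_distrib_numeral)
  also have "\<dots> \<le> 2 * \<Delta>\<^sub>F + real T * (3 / 4 * \<epsilon> * r)"
  proof -
    have "a 0 = tr.expectation (\<lambda>\<omega>. F x0)"
      unfolding a_def by (intro Bochner_Integration.integral_cong) (auto simp: tr.x_init)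
    then have "a 0 = F x0"
      by (simp add: tr.prob_space)
    moreover have "(INF y. F y) \<le> a T"
      unfolding a_def using bounded_below
      by (intro tr.integral_ge_const tr.integrable_continuous_iterate[OF cont_F]) (auto intro: cINF_lower)
    ultimately show ?thesis
      by (simp add: gap(1))
  qed
  \<comment> \<open>Three quarters of the right-hand side are already spent, so it remains that
    \<open>8 * \<Delta>\<^sub>F \<le> T * r * \<epsilon>\<close>. Since
    \<open>r * (4 * L0 + 16 * \<beta>) = \<epsilon>\<close>, the unrounded horizon attains
    equality.\<close>
  also have "\<dots> \<le> real T * r * \<epsilon>"
  proof -
    have "32 * \<Delta>\<^sub>F * (L0 + 4 * \<beta>) / \<epsilon>\<^sup>2 * (r * \<epsilon>)
        = 8 * \<Delta>\<^sub>F * (r * (4 * L0 + 16 * \<beta>)) * \<epsilon> / \<epsilon>\<^sup>2"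
      by (simp add: algebra_simps)
    then have "8 * \<Delta>\<^sub>F = 32 * \<Delta>\<^sub>F * (L0 + 4 * \<beta>) / \<epsilon>\<^sup>2 * (r * \<epsilon>)"
      unfolding r(2) using eps_pos by (simp add: power2_eq_square)
    also have "\<dots> \<le> real T * (r * \<epsilon>)"
      using T r(1) eps_pos by (intro mult_right_mono) auto
    finally show ?thesis
      by (simp add: algebra_simps)
  qed
  finally have "r * (\<Sum>t<T. n t) \<le> r * (real T * \<epsilon>)"
    by (simp add: sum_distrib_left mult_ac)
  then have avg: "(\<Sum>t<T. n t) / real T \<le> \<epsilon>"
    using r(1) \<open>0 < T\<close> by (simp add: field_simps)
  \<comment> \<open>The random index is independent of \<open>\<F> T\<close>, so all gradient norms
    are placed in this one sigma-algebra by monotonicity of the filtration.\<close>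
  have adapted: "(\<lambda>\<omega>. norm (gradient F (x t \<omega>))) \<in> borel_measurable (\<F> T)" if "t < T" for t
  proof -
    have "x t \<in> borel_measurable (\<F> T)"
      using tr.x_adapted[of t] that tr.sets_F_mono[of t T] tr.space_F
      by (auto intro: measurable_mono[THEN subsetD, rotated 4])
    then show ?thesis
      using measurable_compose borel_measurable_continuous_onI[OF cont] by blast
  qed
  have int: "integrable M (\<lambda>\<omega>. norm (gradient F (x t \<omega>)))" if "t < T" for t
    using that by (intro tr.integrable_continuous_iterate[OF cont]) simp
  note uniform = tr.uniform_index_expectation[where h = "\<lambda>t \<omega>. norm (gradient F (x t \<omega>))",
      OF tbar_measurable tbar_uniform tr.subalgebra tbar_indep adapted int]
  show "integrable M (\<lambda>\<omega>. norm (gradient F (x (tbar \<omega>) \<omega>))) \<and>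
      (\<integral>\<omega>. norm (gradient F (x (tbar \<omega>) \<omega>)) \<partial>M) \<le> \<epsilon>"
    using uniform avg by (simp add: n_def)
  show "\<exists>C>0. \<forall>gap>0. \<forall>l>0. \<forall>b\<ge>0. \<forall>\<sigma>>0. \<forall>\<^sub>F \<eta> in at_right 0.
      real (tr_horizon gap l b \<eta> * tr_batch_size \<sigma> \<eta>) \<le> C * (gap * (l + b) * \<sigma>\<^sup>2 / \<eta> ^ 4)"
    by (intro exI[of _ 32768] conjI allI impI sample_complexity) simp_all
qed

end
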